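(* Let $w^\star=(x^\star,y^\star)\in W^\star$. Assume that there exist an affine set $\mathcal F\subset\mathbb R^n$ with $x^\star\in\mathcal F$, a neighborhood $U_x$ of $x^\star$, a symmetric matrix $H_{\mathcal F}\succeq0$ and a vector $c_{\mathcal F}\in\mathbb R^n$ such that, with $\mathcal L_{\mathcal F}:=\operatorname{span}(\mathcal F-\mathcal F)$, $\partial g(x)=H_{\mathcal F}x+c_{\mathcal F}+\mathcal L_{\mathcal F}^\perp$ for all $x\in\mathcal F\cap U_x$. Suppose also that $f$ is twice continuously differentiable near $x^\star$. Then $\mathcal T_{\rm red}$ is continuously differentiable near $z^\star=(0,y^\star)$, with Jacobian $$D\mathcal T_{\rm red}(z^\star)=\begin{pmatrix} \Pi_{\mathcal F}\bigl(\nabla^2f(x^\star)+H_{\mathcal F}+\sigma A^\top A\bigr)\Pi_{\mathcal F} & -\Pi_{\mathcal F}A^\top \\ A\Pi_{\mathcal F} & 0 \end{pmatrix},$$ viewed as a linear operator on $\mathcal L_{\mathcal F}\times\mathbb R^m$. If this operator is nonsingular, then there exist a neighborhood $V_{\rm red}$ of $z^\star$ in $\mathcal L_{\mathcal F}\times\mathbb R^m$ and a constant $\alpha_{\rm red}>0$ such that $$\alpha_{\rm red}\|z-z^\star\|\le\|\mathcal T_{\rm red}(z)\|\qquad\forall z\in V_{\rm red}.$$ In particular, after possibly shrinking $V_{\rm red}$, the reduced error bound $\alpha_{\rm red}\operatorname{dist}(z,Z_{\rm red})\le\|\mathcal T_{\rm red}(z)\|$ for all $z\in V_{\rm red}$ holds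 with $Z_{\rm red}=\{z^\star\}$.
   Context: Setting: $A\in\mathbb R^{m\times n}$, $b\in\mathbb R^m$, $\sigma\ge0$; $f:\mathbb R^n\to\mathbb R$ is convex and continuously differentiable with Lipschitz continuous gradient; $g:\mathbb R^n\to(-\infty,+\infty]$ is proper, closed and convex. The set-valued augmented KKT operator is $$\mathcal T(x,y)=\begin{pmatrix} \nabla f(x)+\partial g(x)-A^\top y+\sigma A^\top(Ax-b) \\ Ax-b \end{pmatrix},\qquad W^\star:=\mathcal T^{-1}(0).$$ $\Pi_{\mathcal F}$ is the orthogonal projector of $\mathbb R^n$ onto $\mathcal L_{\mathcal F}$. The reduced KKT mapping on $\mathcal L_{\mathcal F}\times\mathbb R^m$ is $$\mathcal T_{\rm red}(u,y):=\begin{pmatrix} \Pi_{\mathcal F}\bigl(\nabla f(x^\star+u)+H_{\mathcal F}(x^\star+u)+c_{\mathcal F}-A^\top y+\sigma A^\top Au\bigr) \\ Au \end{pmatrix}.$$ $Z_{\rm red}$ denotes the set of zeros of $\mathcal T_{\rm red}$ in a neighborhood $U_{\rm red}$ of $z^\star$ in $\mathcal L_{\mathcal F}\times\mathbb R^m$ on which $\operatorname{dist}(0,\mathcal T(x^\star+u,y))=\|\mathcal T_{\rm red}(u,y)\|$. Norms and distances are Euclidean. *)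

theory Defs
  imports "HOL-Analysis.Analysis"
begin

definition grad :: "('a::real_inner \<Rightarrow> real) \<Rightarrow> 'a \<Rightarrow> 'a" where
  "grad f x = (THE D. GDERIV f x :> D)"

definition hessian :: "(real^'n \<Rightarrow> real) \<Rightarrow> real^'n \<Rightarrow> real^'n^'n" where
  "hessian f x = jacobian (grad f) (at x)"

definition C2_near :: "(real^'n \<Rightarrow> real) \<Rightarrow> real^'n \<Rightarrow> bool" where
  "C2_near f x \<longleftrightarrow> (\<exists>N. open N \<and> x \<in> N \<and>
     f differentiable_on N \<and> grad f differentiable_on N \<and> continuous_on N (hessian f))"

text \<open>The library's \<^term>\<open>epigraph\<close> and \<^term>\<open>convex_on\<close> are for real-valued functions, so
  closedness and convexity of an extended-valued function are stated through its epigraph,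
  which is a subset of the space times the (finite) reals.\<close>

definition ext_epigraph :: "('a \<Rightarrow> ereal) \<Rightarrow> ('a \<times> real) set" where
  "ext_epigraph g = {(x, r). g x \<le> ereal r}"

definition proper_closed_convex :: "('a::real_normed_vector \<Rightarrow> ereal) \<Rightarrow> bool" where
  "proper_closed_convex g \<longleftrightarrow>
     (\<forall>x. g x \<noteq> -\<infinity>) \<and> (\<exists>x. g x \<noteq> \<infinity>) \<and>
     closed (ext_epigraph g) \<and> convex (ext_epigraph g)"

text \<open>For proper \<^term>\<open>g\<close> this is empty at points where \<^term>\<open>g\<close> is infinite.\<close>

definition subdifferential :: "('a::real_inner \<Rightarrow> ereal) \<Rightarrow> 'a \<Rightarrow> 'a set" where
  "subdifferential g x = {v. \<forall>y. g x + ereal (v \<bullet> (y - x)) \<le> g y}"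

definition dir_space :: "'a::real_vector set \<Rightarrow> 'a set" where
  "dir_space F = span {x - y | x y. x \<in> F \<and> y \<in> F}"

definition orth_proj :: "'a::real_inner set \<Rightarrow> 'a \<Rightarrow> 'a" where
  "orth_proj L x = (THE p. p \<in> L \<and> (\<forall>v\<in>L. orthogonal v (x - p)))"

text \<open>Neighbourhoods (not necessarily open) of a point relative to a set \<^term>\<open>E\<close>.\<close>

definition nbhd_in :: "'a::topological_space set \<Rightarrow> 'a \<Rightarrow> 'a set \<Rightarrow> bool" where
  "nbhd_in E z V \<longleftrightarrow> V \<subseteq> E \<and> (\<exists>W. openin (top_of_set E) W \<and> z \<in> W \<and> W \<subseteq> V)"

definition kkt_op ::
  "real^'n^'m \<Rightarrow> real^'m \<Rightarrow> real \<Rightarrow> (real^'n \<Rightarrow> real) \<Rightarrow> (real^'n \<Rightarrow> ereal)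
    \<Rightarrow> (real^'n) \<times> (real^'m) \<Rightarrow> ((real^'n) \<times> (real^'m)) set" where
  "kkt_op A b \<sigma> f g = (\<lambda>(x, y).
     {(grad f x + v - transpose A *v y + \<sigma> *\<^sub>R (transpose A *v (A *v x - b)), A *v x - b)
      | v. v \<in> subdifferential g x})"

definition kkt_points ::
  "real^'n^'m \<Rightarrow> real^'m \<Rightarrow> real \<Rightarrow> (real^'n \<Rightarrow> real) \<Rightarrow> (real^'n \<Rightarrow> ereal)
    \<Rightarrow> ((real^'n) \<times> (real^'m)) set" where
  "kkt_points A b \<sigma> f g = {w. 0 \<in> kkt_op A b \<sigma> f g w}"

text \<open>The space of the reduced variables; \<open>red_map\<close> is given by a formula on the whole product
  space but is only ever considered on \<open>red_space F\<close>, which it maps into itself.\<close>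

definition red_space :: "(real^'n) set \<Rightarrow> ((real^'n) \<times> (real^'m)) set" where
  "red_space F = dir_space F \<times> UNIV"

definition red_map ::
  "real^'n^'m \<Rightarrow> real \<Rightarrow> (real^'n \<Rightarrow> real) \<Rightarrow> (real^'n) set \<Rightarrow> real^'n^'n \<Rightarrow> real^'n \<Rightarrow> real^'n
    \<Rightarrow> (real^'n) \<times> (real^'m) \<Rightarrow> (real^'n) \<times> (real^'m)" where
  "red_map A \<sigma> f F H c x0 = (\<lambda>(u, y).
     (orth_proj (dir_space F)
        (grad f (x0 + u) + H *v (x0 + u) + c - transpose A *v y
          + \<sigma> *\<^sub>R (transpose A *v (A *v u))),
      A *v u))"

definition red_jacobian ::
  "real^'n^'m \<Rightarrow> real \<Rightarrow> (real^'n \<Rightarrow> real) \<Rightarrow> (real^'n) set \<Rightarrow> real^'n^'n \<Rightarrow> real^'n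
    \<Rightarrow> (real^'n) \<times> (real^'m) \<Rightarrow> (real^'n) \<times> (real^'m)" where
  "red_jacobian A \<sigma> f F H x0 = (\<lambda>(h, k).
     let P = orth_proj (dir_space F) in
     (P ((hessian f x0 + H + \<sigma> *\<^sub>R (transpose A ** A)) *v P h) - P (transpose A *v k),
      A *v P h))"

text \<open>Neighbourhoods of \<open>(0, y0)\<close> on which the distance from 0 to the value of the KKT operator is
  the norm of the reduced map. Nonemptiness is required because the distance to the empty
  set should be infinite, whereas \<^term>\<open>infdist\<close> makes it 0.\<close>

definition red_nbhd ::
  "real^'n^'m \<Rightarrow> real^'m \<Rightarrow> real \<Rightarrow> (real^'n \<Rightarrow> real) \<Rightarrow> (real^'n \<Rightarrow> ereal)
    \<Rightarrow> (real^'n) set \<Rightarrow> real^'n^'n \<Rightarrow> real^'n \<Rightarrow> real^'n \<Rightarrow> real^'m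
    \<Rightarrow> ((real^'n) \<times> (real^'m)) set \<Rightarrow> bool" where
  "red_nbhd A b \<sigma> f g F H c x0 y0 U \<longleftrightarrow>
     nbhd_in (red_space F) (0, y0) U \<and>
     (\<forall>(u, y)\<in>U. kkt_op A b \<sigma> f g (x0 + u, y) \<noteq> {} \<and>
        infdist 0 (kkt_op A b \<sigma> f g (x0 + u, y)) = norm (red_map A \<sigma> f F H c x0 (u, y)))"

end

theory Submission
  imports Defs
begin

text \<open>On \<open>F\<close> near \<open>x0\<close> the value of the KKT operator is a translate of \<open>L\<^sup>\<bottom> \<times> {0}\<close>, where \<open>L\<close>
  is the direction space of \<open>F\<close>, so its distance from 0 is the norm of the reduced map. A
  nonsingular Jacobian on the finite-dimensional space \<open>L \<times> \<real>\<^sup>m\<close> is bounded below, which yields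
  the local error bound from differentiability at the solution alone. Uniqueness of the zero on
  an arbitrary admissible neighbourhood, not only on a small one, follows from the convexity of
  the KKT set.\<close>

section \<open>Orthogonal projection onto a subspace\<close>

text \<open>Makes the description in \<open>orth_proj\<close> well defined. Uniqueness: the
  difference of two candidates lies in \<open>L\<close> and is orthogonal to itself.\<close>

lemma orth_proj_unique_exists:
  fixes L :: "'a::euclidean_space set"
  assumes "subspace L"
  shows "\<exists>!p. p \<in> L \<and> (\<forall>v\<in>L. orthogonal v (x - p))"
proof -
  obtain y z where yz: "y \<in> span L" "\<And>w. w \<in> span L \<Longrightarrow> orthogonal z w" "x = y + z"
    using orthogonal_subspace_decomp_exists[of L x] by blast
  have sp: "span L = L"
    using assms span_eq_iff by blast
  show ?thesis
  proof (rule ex1I[of _ y])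
    show "y \<in> L \<and> (\<forall>v\<in>L. orthogonal v (x - y))"
      using yz sp by (auto simp: orthogonal_commute)
  next
    fix p assume p: "p \<in> L \<and> (\<forall>v\<in>L. orthogonal v (x - p))"
    then have "p - y \<in> L"
      using yz sp assms subspace_diff by blast
    then have "(p - y) \<bullet> (x - p) = 0" "(p - y) \<bullet> (x - y) = 0"
      using p yz sp by (simp_all add: orthogonal_def) (metis inner_commute)
    then have "(p - y) \<bullet> (p - y) = 0"
      by (simp add: inner_diff_right)
    then show "p = y" by simp
  qed
qed

lemma orth_proj_in:
  fixes L :: "'a::euclidean_space set"
  assumes "subspace L"
  shows "orth_proj L x \<in> L"
  unfolding orth_proj_def using theI'[OF orth_proj_unique_exists[OF assms]] by blast

lemma orth_proj_residual:
  fixes L :: "'a::euclidean_space set"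
  assumes "subspace L"
  shows "x - orth_proj L x \<in> L\<^sup>\<bottom>"
  unfolding orth_proj_def orthogonal_comp_def
  using theI'[OF orth_proj_unique_exists[OF assms], of x] by blast

lemma orth_proj_eqI:
  fixes L :: "'a::euclidean_space set"
  assumes "subspace L" "p \<in> L" "x - p \<in> L\<^sup>\<bottom>"
  shows "orth_proj L x = p"
  unfolding orth_proj_def
  by (rule the1_equality[OF orth_proj_unique_exists[OF assms(1)]])
     (use assms in \<open>auto simp: orthogonal_comp_def\<close>)

lemma orth_proj_id:
  fixes L :: "'a::euclidean_space set"
  assumes "subspace L" "x \<in> L"
  shows "orth_proj L x = x"
  by (rule orth_proj_eqI) (use assms in \<open>auto simp: subspace_0 subspace_orthogonal_comp\<close>)

lemma bounded_linear_orth_proj: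
  fixes L :: "'a::euclidean_space set"
  assumes "subspace L"
  shows "bounded_linear (orth_proj L)"
proof -
  have "orth_proj L (x + y) = orth_proj L x + orth_proj L y" for x y
    using subspace_add[OF subspace_orthogonal_comp orth_proj_residual[OF assms, of x]
        orth_proj_residual[OF assms, of y]]
    by (intro orth_proj_eqI[OF assms]) (simp_all add: assms orth_proj_in subspace_add algebra_simps)
  moreover have "orth_proj L (r *\<^sub>R x) = r *\<^sub>R orth_proj L x" for r x
    using subspace_scale[OF subspace_orthogonal_comp orth_proj_residual[OF assms, of x], of r]
    by (intro orth_proj_eqI[OF assms]) (simp_all add: assms orth_proj_in subspace_scale algebra_simps)
  ultimately show ?thesis
    by (simp add: linearI linear_conv_bounded_linear[symmetric])
qed

lemma orth_proj_add_comp: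
  fixes L :: "'a::euclidean_space set"
  assumes "subspace L" "v \<in> L\<^sup>\<bottom>"
  shows "orth_proj L (x + v) = orth_proj L x"
  using subspace_add[OF subspace_orthogonal_comp orth_proj_residual[OF assms(1), of x] assms(2)]
  by (intro orth_proj_eqI[OF assms(1)]) (simp_all add: assms(1) orth_proj_in algebra_simps)

lemma norm_orth_proj_le:
  fixes L :: "'a::euclidean_space set"
  assumes "subspace L"
  shows "norm (orth_proj L x) \<le> norm x"
proof -
  have "orthogonal (orth_proj L x) (x - orth_proj L x)"
    using orth_proj_in[OF assms] orth_proj_residual[OF assms]
    by (auto simp: orthogonal_comp_def)
  from norm_add_Pythagorean[OF this] have "(norm (orth_proj L x))\<^sup>2 \<le> (norm x)\<^sup>2"
    by simp
  then show ?thesis by simp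
qed

text \<open>All first components in \<open>S\<close> have the same projection, and projecting never
  increases the norm, which bounds the distance below. The choice
  \<open>v = orth_proj L w - w\<close> attains the bound.\<close>

lemma infdist_0_translate_comp:
  fixes L :: "'a::euclidean_space set" and q :: "'b::euclidean_space"
  assumes L: "subspace L" and S: "S = {(w + v, q) | v. v \<in> L\<^sup>\<bottom>}"
  shows "infdist 0 S = norm (orth_proj L w, q)"
proof (rule antisym)
  have "orth_proj L w - w \<in> L\<^sup>\<bottom>"
    using subspace_neg[OF subspace_orthogonal_comp orth_proj_residual[OF L, of w]] by simp
  then have "(w + (orth_proj L w - w), q) \<in> S"
    unfolding S by blast
  then have mem: "(orth_proj L w, q) \<in> S"
    by simp
  from infdist_le[OF this, of 0] show "infdist 0 S \<le> norm (orth_proj L w, q)"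
    by simp
  have "norm (orth_proj L w, q) \<le> dist 0 s" if s: "s \<in> S" for s
  proof -
    obtain v where v: "s = (w + v, q)" "v \<in> L\<^sup>\<bottom>"
      using s unfolding S by blast
    have "norm (orth_proj L w) \<le> norm (w + v)"
      using norm_orth_proj_le[OF L, of "w + v"] orth_proj_add_comp[OF L v(2)] by simp
    then show ?thesis
      unfolding v(1) by (simp add: norm_Pair power_mono)
  qed
  then show "norm (orth_proj L w, q) \<le> infdist 0 S"
    using mem by (auto simp: infdist_def intro!: cINF_greatest)
qed

section \<open>Gradients of convex functions\<close>

text \<open>The representing vector of the derivative is its adjoint applied to 1. It is unique
  because derivatives are, so the description in \<open>grad\<close> picks it.\<close>

lemma GDERIV_grad:
  fixes f :: "'a::euclidean_space \<Rightarrow> real"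
  assumes "f differentiable (at x)"
  shows "GDERIV f x :> grad f x"
proof -
  obtain f' where f': "(f has_derivative f') (at x)"
    using assms differentiable_def by blast
  have "f' h = h \<bullet> adjoint f' 1" for h
    using adjoint_works[OF has_derivative_linear[OF f'], of h 1] by simp
  then have ex: "GDERIV f x :> adjoint f' 1"
    using f' unfolding gderiv_def by (metis (no_types, lifting) ext)
  have "D = adjoint f' 1" if "GDERIV f x :> D" for D
  proof -
    have "(\<lambda>h. h \<bullet> D) = (\<lambda>h. h \<bullet> adjoint f' 1)"
      using that ex has_derivative_unique unfolding gderiv_def by blast
    then show ?thesis
      by (metis vector_eq_ldot)
  qed
  with ex show ?thesis
    unfolding grad_def by (rule theI)
qed

text \<open>Restricting \<open>f\<close> to the line through \<open>x\<close> and \<open>y\<close>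
  reduces the claim to the tangent inequality for a convex function of one real variable, taken
  between 0 and 1.\<close>

lemma convex_on_gradient_ineq:
  fixes f :: "'a::euclidean_space \<Rightarrow> real"
  assumes "convex_on UNIV f" and "f differentiable (at x)"
  shows "f x + grad f x \<bullet> (y - x) \<le> f y"
proof -
  define \<phi> where "\<phi> = (\<lambda>t. f (x + t *\<^sub>R (y - x)))"
  have "convex_on UNIV \<phi>"
  proof (rule convex_onI)
    fix t a b :: real assume t: "0 < t" "t < 1"
    have "x + ((1 - t) *\<^sub>R a + t *\<^sub>R b) *\<^sub>R (y - x)
        = (1 - t) *\<^sub>R (x + a *\<^sub>R (y - x)) + t *\<^sub>R (x + b *\<^sub>R (y - x))"
      by (simp add: algebra_simps)
    then show "\<phi> ((1 - t) *\<^sub>R a + t *\<^sub>R b) \<le> (1 - t) * \<phi> a + t * \<phi> b"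
      unfolding \<phi>_def using convex_onD[OF assms(1)] t by simp
  qed auto
  moreover have "(\<phi> has_field_derivative (y - x) \<bullet> grad f x) (at 0)"
  proof -
    have "(f has_derivative (\<lambda>h. h \<bullet> grad f x)) (at (x + 0 *\<^sub>R (y - x)))"
      using GDERIV_grad[OF assms(2)] by (simp add: gderiv_def)
    moreover have "((\<lambda>t. x + t *\<^sub>R (y - x)) has_derivative (\<lambda>t. t *\<^sub>R (y - x))) (at 0)"
      by (auto intro!: derivative_eq_intros)
    ultimately have "(\<phi> has_derivative (\<lambda>t. (t *\<^sub>R (y - x)) \<bullet> grad f x)) (at 0)"
      unfolding \<phi>_def by (rule has_derivative_compose[rotated])
    then show ?thesis
      by (simp add: has_field_derivative_def mult_commute_abs)
  qed
  ultimately have "((y - x) \<bullet> grad f x) * (1 - 0) \<le> \<phi> 1 - \<phi> 0"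
    by (intro convex_on_imp_above_tangent[of UNIV]) auto
  then show ?thesis
    by (simp add: \<phi>_def inner_commute)
qed

text \<open>The point \<open>x\<close> minimizes \<open>f\<close> minus the linear form of
  \<open>p\<close>, so the derivative of this difference vanishes there; evaluate it in the
  direction \<open>grad f x - p\<close>.\<close>

lemma grad_eq_of_tangent_minorant:
  fixes f :: "'a::euclidean_space \<Rightarrow> real"
  assumes "f differentiable (at x)" and min: "\<And>z. f x + p \<bullet> (z - x) \<le> f z"
  shows "grad f x = p"
proof -
  have "((\<lambda>z. f z - p \<bullet> z) has_derivative (\<lambda>h. h \<bullet> grad f x - p \<bullet> h)) (at x)"
    using GDERIV_grad[OF assms(1)] unfolding gderiv_def
    by (auto intro!: derivative_eq_intros)
  moreover have "f x - p \<bullet> x \<le> f z - p \<bullet> z" for z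
    using min[of z] by (simp add: inner_diff_right)
  ultimately have "(\<lambda>h. h \<bullet> grad f x - p \<bullet> h) = (\<lambda>h. 0)"
    by (intro has_derivative_local_min) auto
  then have "(grad f x - p) \<bullet> (grad f x - p) = 0"
    by (metis inner_commute inner_diff_left)
  then show ?thesis by simp
qed

section \<open>Subgradients, and segments along which monotonicity is tight\<close>

text \<open>Compare with a point where \<open>g\<close> is not infinite. This turns subgradient
  inequalities between extended reals into real ones.\<close>

lemma subdifferential_finite:
  assumes "proper_closed_convex g" "v \<in> subdifferential g x"
  obtains r where "g x = ereal r"
proof -
  obtain z where "g z \<noteq> \<infinity>"
    using assms(1) by (auto simp: proper_closed_convex_def)
  moreover have "g x + ereal (v \<bullet> (z - x)) \<le> g z"
    using assms(2) by (simp add: subdifferential_def)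
  ultimately have "g x \<noteq> \<infinity>" by auto
  moreover have "g x \<noteq> -\<infinity>"
    using assms(1) by (auto simp: proper_closed_convex_def)
  ultimately show thesis using that by (cases "g x") auto
qed

text \<open>An intersection over \<open>y\<close> of sets each given by one affine inequality in
  \<open>v\<close>, or the whole space where \<open>g y\<close> is infinite.\<close>

lemma closed_subdifferential:
  assumes "proper_closed_convex g"
  shows "closed (subdifferential g x)"
proof (cases "subdifferential g x = {}")
  case False
  then obtain r where r: "g x = ereal r"
    using subdifferential_finite[OF assms] by blast
  have "closed {v. g x + ereal (v \<bullet> (y - x)) \<le> g y}" for y
  proof (cases "g y")
    case (real s)
    have "closed {v. r + v \<bullet> (y - x) \<le> s}"
      by (intro closed_Collect_le continuous_intros)
    then show ?thesis by (simp add: r real)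
  next
    case MInf
    then show ?thesis using assms by (auto simp: proper_closed_convex_def)
  qed simp
  then show ?thesis
    unfolding subdifferential_def by (intro closed_Collect_all) auto
qed simp

text \<open>The convex combination of the two subgradient inequalities differs from the wanted one
  by a multiple of the monotonicity gap, whose sign is controlled by \<open>mono\<close>. Since
  subdifferentials are monotone, the hypothesis amounts to a gap of zero.\<close>

lemma mem_subdifferential_segment:
  fixes g :: "'a::real_inner \<Rightarrow> ereal"
  assumes g: "proper_closed_convex g"
    and v: "v1 \<in> subdifferential g x1" "v2 \<in> subdifferential g x2"
    and mono: "(v1 - v2) \<bullet> (x1 - x2) \<le> 0" and t: "0 \<le> t" "t \<le> 1"
  shows "(1 - t) *\<^sub>R v1 + t *\<^sub>R v2 \<in> subdifferential g ((1 - t) *\<^sub>R x1 + t *\<^sub>R x2)"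
proof -
  let ?x = "(1 - t) *\<^sub>R x1 + t *\<^sub>R x2" and ?v = "(1 - t) *\<^sub>R v1 + t *\<^sub>R v2"
  obtain r1 r2 where r: "g x1 = ereal r1" "g x2 = ereal r2"
    using subdifferential_finite[OF g v(1)] subdifferential_finite[OF g v(2)] by metis
  \<comment> \<open>Convexity of \<open>g\<close> is available only through its epigraph, so the
    values at the two ends enter as heights of epigraph points.\<close>
  have "(x1, r1) \<in> ext_epigraph g" "(x2, r2) \<in> ext_epigraph g"
    by (auto simp: ext_epigraph_def r)
  then have "(1 - t) *\<^sub>R (x1, r1) + t *\<^sub>R (x2, r2) \<in> ext_epigraph g"
    using g t by (intro convexD) (auto simp: proper_closed_convex_def)
  then have gx: "g ?x \<le> ereal ((1 - t) * r1 + t * r2)"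
    by (simp add: ext_epigraph_def)
  have cross: "(1 - t) * t * ((v1 - v2) \<bullet> (x1 - x2)) \<le> 0"
    using mono t by (simp add: mult_nonneg_nonpos)
  have "g ?x + ereal (?v \<bullet> (z - ?x)) \<le> g z" for z
  proof (cases "g z")
    case (real s)
    have 1: "r1 + v1 \<bullet> (z - x1) \<le> s" and 2: "r2 + v2 \<bullet> (z - x2) \<le> s"
      using v[unfolded subdifferential_def] real r
      by (auto dest!: spec[of _ z])
    have "(1 - t) * (r1 + v1 \<bullet> (z - x1)) + t * (r2 + v2 \<bullet> (z - x2)) \<le> (1 - t) * s + t * s"
      using 1 2 t by (intro add_mono mult_left_mono) auto
    moreover have "?v \<bullet> (z - ?x) = (1 - t) * (v1 \<bullet> (z - x1)) + t * (v2 \<bullet> (z - x2))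
        + (1 - t) * t * ((v1 - v2) \<bullet> (x1 - x2))"
      by (simp add: inner_simps) (simp add: algebra_simps)
    ultimately have "(1 - t) * r1 + t * r2 + ?v \<bullet> (z - ?x) \<le> s"
      using cross by (simp add: algebra_simps)
    then have "ereal ((1 - t) * r1 + t * r2) + ereal (?v \<bullet> (z - ?x)) \<le> g z"
      by (simp add: real)
    then show ?thesis
      using gx by (meson add_right_mono order_trans)
  next
    case MInf
    then show ?thesis using g by (auto simp: proper_closed_convex_def)
  qed simp
  then show ?thesis by (simp add: subdifferential_def)
qed

text \<open>The tangent of \<open>f\<close> at \<open>x1\<close> lies below \<open>f\<close>; with
  \<open>mono\<close>, the tangent at \<open>x2\<close> forces \<open>f x2\<close> down onto it. By
  convexity \<open>f\<close> then meets this affine minorant along the whole segment, so its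
  gradient there is the slope of the minorant.\<close>

lemma grad_segment:
  fixes f :: "'a::euclidean_space \<Rightarrow> real"
  assumes f: "convex_on UNIV f" "f differentiable_on UNIV"
    and mono: "(grad f x1 - grad f x2) \<bullet> (x1 - x2) \<le> 0" and t: "0 \<le> t" "t \<le> 1"
  shows "grad f ((1 - t) *\<^sub>R x1 + t *\<^sub>R x2) = grad f x1"
proof -
  let ?x = "(1 - t) *\<^sub>R x1 + t *\<^sub>R x2" and ?p = "grad f x1"
  have diff: "f differentiable (at x)" for x
    using f(2) by (simp add: differentiable_on_def)
  note tangent = convex_on_gradient_ineq[OF f(1) diff]
  have "f x2 \<le> f x1 + ?p \<bullet> (x2 - x1)"
    using tangent[of x2 x1] mono by (simp add: inner_simps)
  then have "t * f x2 \<le> t * (f x1 + ?p \<bullet> (x2 - x1))"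
    using t by (intro mult_left_mono)
  moreover have "f ?x \<le> (1 - t) * f x1 + t * f x2"
    using convex_onD[OF f(1)] t by simp
  ultimately have "f ?x \<le> f x1 + ?p \<bullet> (?x - x1)"
    by (simp add: inner_simps) (simp add: algebra_simps)
  then have "f ?x + ?p \<bullet> (z - ?x) \<le> f z" for z
    using tangent[of x1 z] by (simp add: inner_simps)
  then show ?thesis
    by (rule grad_eq_of_tangent_minorant[OF diff])
qed

section \<open>The KKT set and its link with the reduced map\<close>

text \<open>The second component forces feasibility, which makes the penalty term vanish; hence
  \<open>\<sigma>\<close> is absent on the right.\<close>

lemma kkt_points_iff:
  "(x, y) \<in> kkt_points A b \<sigma> f g \<longleftrightarrow>
     A *v x = b \<and> transpose A *v y - grad f x \<in> subdifferential g x"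
proof -
  have "grad f x + v - transpose A *v y = 0 \<longleftrightarrow> v = transpose A *v y - grad f x" for v
    by (auto simp: algebra_simps)
  then show ?thesis
    unfolding kkt_points_def kkt_op_def by (auto simp: zero_prod_def)
qed

lemma subdifferential_monotone:
  assumes g: "proper_closed_convex g"
    and v: "v1 \<in> subdifferential g x1" "v2 \<in> subdifferential g x2"
  shows "0 \<le> (v1 - v2) \<bullet> (x1 - x2)"
proof -
  obtain r1 r2 where r: "g x1 = ereal r1" "g x2 = ereal r2"
    using subdifferential_finite[OF g v(1)] subdifferential_finite[OF g v(2)] by metis
  have "r1 + v1 \<bullet> (x2 - x1) \<le> r2" "r2 + v2 \<bullet> (x1 - x2) \<le> r1"
    using v[unfolded subdifferential_def] r by (auto dest: spec[of _ x1] spec[of _ x2])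
  then show ?thesis by (simp add: inner_simps)
qed

lemma grad_monotone:
  fixes f :: "'a::euclidean_space \<Rightarrow> real"
  assumes f: "convex_on UNIV f" "f differentiable_on UNIV"
  shows "0 \<le> (grad f x1 - grad f x2) \<bullet> (x1 - x2)"
proof -
  have "f differentiable (at x)" for x
    using f(2) by (simp add: differentiable_on_def)
  from convex_on_gradient_ineq[OF f(1) this, of x1 x2] convex_on_gradient_ineq[OF f(1) this, of x2 x1]
  show ?thesis by (simp add: inner_simps)
qed

text \<open>Two KKT points are both primal feasible, so the multiplier terms do not contribute to the
  monotonicity gap; hence \<^term>\<open>grad f\<close> and the subgradients of \<^term>\<open>g\<close> both have gap zero.\<close>

lemma convex_kkt_points:
  fixes A :: "real^'n^'m"
  assumes f: "convex_on UNIV f" "f differentiable_on UNIV"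
    and g: "proper_closed_convex g"
  shows "convex (kkt_points A b \<sigma> f g)"
  unfolding convex_alt
proof (intro ballI allI impI)
  fix w1 w2 :: "(real^'n) \<times> (real^'m)" and t :: real
  assume w: "w1 \<in> kkt_points A b \<sigma> f g" "w2 \<in> kkt_points A b \<sigma> f g" and t: "0 \<le> t \<and> t \<le> 1"
  obtain x1 y1 x2 y2 where w_eq: "w1 = (x1, y1)" "w2 = (x2, y2)"
    by (metis surj_pair)
  let ?v1 = "transpose A *v y1 - grad f x1" and ?v2 = "transpose A *v y2 - grad f x2"
  have Ax: "A *v x1 = b" "A *v x2 = b"
    and v: "?v1 \<in> subdifferential g x1" "?v2 \<in> subdifferential g x2"
    using w by (auto simp: w_eq kkt_points_iff)
  have "(transpose A *v (y1 - y2)) \<bullet> (x1 - x2) = (y1 - y2) \<bullet> (A *v (x1 - x2))"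
    by (simp add: dot_lmul_matrix)
  also have "\<dots> = 0"
    by (simp add: matrix_vector_mult_diff_distrib Ax)
  finally have gap: "(?v1 - ?v2) \<bullet> (x1 - x2) = - ((grad f x1 - grad f x2) \<bullet> (x1 - x2))"
    by (simp add: matrix_vector_mult_diff_distrib inner_simps)
  have mono_g: "(?v1 - ?v2) \<bullet> (x1 - x2) \<le> 0"
    using gap grad_monotone[OF f, of x1 x2] by simp
  have mono_f: "(grad f x1 - grad f x2) \<bullet> (x1 - x2) \<le> 0"
    using gap subdifferential_monotone[OF g v] by simp
  have grad_t: "grad f ((1 - t) *\<^sub>R x1 + t *\<^sub>R x2) = grad f x1"
    using grad_segment[OF f mono_f] t by blast
  \<comment> \<open>The endpoint \<open>t = 1\<close> shows that both ends share one gradient, so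
    the required subgradient is affine in \<open>t\<close>.\<close>
  have "grad f x2 = grad f x1"
    using grad_segment[OF f mono_f, of 1] by simp
  then have "transpose A *v ((1 - t) *\<^sub>R y1 + t *\<^sub>R y2) - grad f ((1 - t) *\<^sub>R x1 + t *\<^sub>R x2)
      = (1 - t) *\<^sub>R ?v1 + t *\<^sub>R ?v2"
    unfolding grad_t by (simp add: matrix_vector_right_distrib matrix_vector_mult_scaleR algebra_simps)
  then have "transpose A *v ((1 - t) *\<^sub>R y1 + t *\<^sub>R y2) - grad f ((1 - t) *\<^sub>R x1 + t *\<^sub>R x2)
      \<in> subdifferential g ((1 - t) *\<^sub>R x1 + t *\<^sub>R x2)"
    using mem_subdifferential_segment[OF g v mono_g] t by simp
  moreover have "A *v ((1 - t) *\<^sub>R x1 + t *\<^sub>R x2) = b"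
    by (simp add: matrix_vector_right_distrib matrix_vector_mult_scaleR Ax algebra_simps)
  ultimately show "(1 - t) *\<^sub>R w1 + t *\<^sub>R w2 \<in> kkt_points A b \<sigma> f g"
    by (simp add: w_eq kkt_points_iff)
qed

text \<open>The value is a translated subdifferential times a single point. Closedness lets distance
  zero mean that 0 is a member.\<close>

lemma closed_kkt_op:
  fixes A :: "real^'n^'m"
  assumes "proper_closed_convex g"
  shows "closed (kkt_op A b \<sigma> f g (x, y))"
proof -
  let ?w = "grad f x - transpose A *v y + \<sigma> *\<^sub>R (transpose A *v (A *v x - b))"
  have "kkt_op A b \<sigma> f g (x, y) = (+) ?w ` subdifferential g x \<times> {A *v x - b}"
    unfolding kkt_op_def by (auto simp: image_iff algebra_simps)
  then show ?thesis
    using closed_translation[OF closed_subdifferential[OF assms]] by (simp add: closed_Times)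
qed

lemma infdist_kkt_op_eq_0_iff:
  fixes A :: "real^'n^'m"
  assumes "proper_closed_convex g" "kkt_op A b \<sigma> f g (x, y) \<noteq> {}"
  shows "infdist 0 (kkt_op A b \<sigma> f g (x, y)) = 0 \<longleftrightarrow> (x, y) \<in> kkt_points A b \<sigma> f g"
  using in_closed_iff_infdist_zero[OF closed_kkt_op[OF assms(1)] assms(2)]
  by (simp add: kkt_points_def)

text \<open>Uses only the distance identity built into \<open>red_nbhd\<close>, so it is available
  on every admissible \<open>U\<close>, however large.\<close>

lemma red_nbhd_zero_iff:
  fixes A :: "real^'n^'m"
  assumes "proper_closed_convex g" "red_nbhd A b \<sigma> f g F H c x0 y0 U" "(u, y) \<in> U"
  shows "red_map A \<sigma> f F H c x0 (u, y) = 0 \<longleftrightarrow> (x0 + u, y) \<in> kkt_points A b \<sigma> f g"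
  using assms infdist_kkt_op_eq_0_iff[OF assms(1), of A b \<sigma> f "x0 + u" y]
  unfolding red_nbhd_def by force

section \<open>Relative neighbourhoods, the direction space, and an admissible neighbourhood\<close>

lemma nbhd_in_self: "nbhd_in E z V \<Longrightarrow> z \<in> V"
  unfolding nbhd_in_def by blast

lemma nbhd_in_Int_open:
  assumes "open N" "z \<in> N" "z \<in> E"
  shows "nbhd_in E z (E \<inter> N)"
  using assms unfolding nbhd_in_def by (auto simp: openin_open)

lemma subspace_dir_space: "subspace (dir_space F)"
  by (simp add: dir_space_def)

lemma subspace_red_space: "subspace (red_space F)"
  by (simp add: red_space_def subspace_Times subspace_dir_space)

text \<open>The translate of \<open>F\<close> by \<open>- x\<close> is already a subspace containing
  all differences, so taking the span does not leave it.\<close>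

lemma dir_space_affine:
  assumes "affine F" "x \<in> F" "u \<in> dir_space F"
  shows "x + u \<in> F"
proof -
  have "{y - z | y z. y \<in> F \<and> z \<in> F} \<subseteq> (\<lambda>y. - x + y) ` F"
  proof clarify
    fix y z assume "y \<in> F" "z \<in> F"
    then have "x + 1 *\<^sub>R (y - z) \<in> F"
      using mem_affine_3_minus[OF assms(1,2)] by blast
    then show "y - z \<in> (\<lambda>y. - x + y) ` F"
      by (intro image_eqI[of _ _ "x + (y - z)"]) auto
  qed
  moreover have "subspace ((\<lambda>y. - x + y) ` F)"
    using affine_diffs_subspace assms by blast
  ultimately have "u \<in> (\<lambda>y. - x + y) ` F"
    using assms(3) unfolding dir_space_def by (meson span_minimal subsetD)
  then show ?thesis by auto
qed

text \<open>For \<open>u\<close> in the direction space the point \<open>x0 + u\<close> stays in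
  \<open>F\<close>, and for \<open>(u, y)\<close> in \<open>N\<close> also in \<open>Ux\<close>, so
  the formula for the subdifferential applies. Feasibility of \<open>x0\<close> turns the residual
  into \<open>A *v u\<close>, and \<open>infdist_0_translate_comp\<close> gives the
  distance.\<close>

lemma ex_red_nbhd:
  fixes A :: "real^'n^'m"
  assumes kkt: "(x0, y0) \<in> kkt_points A b \<sigma> f g"
    and F: "affine F" "x0 \<in> F" and Ux: "x0 \<in> interior Ux"
    and sub: "\<forall>x \<in> F \<inter> Ux. subdifferential g x = {H *v x + c + v | v. v \<in> (dir_space F)\<^sup>\<bottom>}"
  shows "\<exists>U. red_nbhd A b \<sigma> f g F H c x0 y0 U"
proof -
  define N where "N = (\<lambda>z::(real^'n) \<times> (real^'m). x0 + fst z) -` interior Ux"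
  have "open N"
    unfolding N_def by (intro continuous_open_vimage continuous_intros) auto
  moreover have "(0, y0) \<in> N" "(0, y0) \<in> red_space F"
    using Ux by (auto simp: N_def red_space_def subspace_0 subspace_dir_space)
  ultimately have nb: "nbhd_in (red_space F) (0, y0) (red_space F \<inter> N)"
    by (rule nbhd_in_Int_open)
  have Ax: "A *v x0 = b"
    using kkt by (simp add: kkt_points_iff)
  have "kkt_op A b \<sigma> f g (x0 + u, y) \<noteq> {} \<and>
      infdist 0 (kkt_op A b \<sigma> f g (x0 + u, y)) = norm (red_map A \<sigma> f F H c x0 (u, y))"
    if uy: "(u, y) \<in> red_space F \<inter> N" for u y
  proof -
    let ?w = "grad f (x0 + u) + H *v (x0 + u) + c - transpose A *v y
          + \<sigma> *\<^sub>R (transpose A *v (A *v u))"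
    have "x0 + u \<in> F \<inter> Ux"
      using uy dir_space_affine[OF F, of u] interior_subset by (auto simp: N_def red_space_def)
    then have sub': "subdifferential g (x0 + u) = {H *v (x0 + u) + c + v | v. v \<in> (dir_space F)\<^sup>\<bottom>}"
      using sub by blast
    have res: "A *v (x0 + u) - b = A *v u"
      by (simp add: matrix_vector_right_distrib Ax)
    have shift: "grad f (x0 + u) + (H *v (x0 + u) + c + v) - transpose A *v y
            + \<sigma> *\<^sub>R (transpose A *v (A *v u)) = ?w + v" for v
      by (simp only: algebra_simps)
    have op: "kkt_op A b \<sigma> f g (x0 + u, y) = {(?w + v, A *v u) | v. v \<in> (dir_space F)\<^sup>\<bottom>}"
    proof -
      have "kkt_op A b \<sigma> f g (x0 + u, y)
        = {(grad f (x0 + u) + (H *v (x0 + u) + c + v) - transpose A *v y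
            + \<sigma> *\<^sub>R (transpose A *v (A *v u)), A *v u) | v. v \<in> (dir_space F)\<^sup>\<bottom>}"
        unfolding kkt_op_def sub' prod.case res by blast
      then show ?thesis
        unfolding shift .
    qed
    have "0 \<in> (dir_space F)\<^sup>\<bottom>"
      by (simp add: subspace_0 subspace_orthogonal_comp)
    then have "kkt_op A b \<sigma> f g (x0 + u, y) \<noteq> {}"
      unfolding op by blast
    moreover have "infdist 0 (kkt_op A b \<sigma> f g (x0 + u, y)) = norm (red_map A \<sigma> f F H c x0 (u, y))"
      using infdist_0_translate_comp[OF subspace_dir_space op] by (simp add: red_map_def)
    ultimately show ?thesis by blast
  qed
  with nb show ?thesis
    unfolding red_nbhd_def by blast
qed

section \<open>Smoothness of the reduced map, the local error bound, and uniqueness of the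
  zero\<close>

text \<open>Apart from \<open>grad f\<close> the map is affine followed by a fixed projection, so
  only the Hessian varies in its derivative. The derivative is computed on the whole product space;
  it matches \<open>red_jacobian\<close> on \<open>red_space F\<close>, where the inner projector
  fixes \<open>fst h\<close>.\<close>

lemma red_map_C1:
  fixes A :: "real^'n^'m" and f :: "real^'n \<Rightarrow> real"
  assumes "C2_near f x0"
  obtains N :: "((real^'n) \<times> (real^'m)) set"
    and D :: "(real^'n) \<times> (real^'m) \<Rightarrow> ((real^'n) \<times> (real^'m)) \<Rightarrow>\<^sub>L ((real^'n) \<times> (real^'m))"
  where "open N" "(0, y0) \<in> N"
    "\<And>z. z \<in> N \<Longrightarrow> (red_map A \<sigma> f F H c x0 has_derivative blinfun_apply (D z)) (at z)"
    "continuous_on N D"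
    "\<And>h. h \<in> red_space F \<Longrightarrow> blinfun_apply (D (0, y0)) h = red_jacobian A \<sigma> f F H x0 h"
proof -
  let ?P = "orth_proj (dir_space F)"
  obtain M where M: "open M" "x0 \<in> M" "grad f differentiable_on M" "continuous_on M (hessian f)"
    using assms unfolding C2_near_def by blast
  define N where "N = (\<lambda>z::(real^'n) \<times> (real^'m). x0 + fst z) -` M"
  define d where "d = (\<lambda>(z::(real^'n) \<times> (real^'m)) h.
      (?P (hessian f (x0 + fst z) *v fst h + H *v fst h - transpose A *v snd h
          + \<sigma> *\<^sub>R (transpose A *v (A *v fst h))), A *v fst h))"
  have P: "bounded_linear ?P"
    by (rule bounded_linear_orth_proj[OF subspace_dir_space])
  note mv = bounded_linear.has_derivative[OF matrix_vector_mul_bounded_linear]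
  have deriv: "(red_map A \<sigma> f F H c x0 has_derivative d z) (at z)" if "z \<in> N" for z
  proof -
    have "grad f differentiable (at (x0 + fst z))"
      using M(1,3) that by (auto simp: N_def differentiable_on_eq_differentiable_at)
    then have "(grad f has_derivative (\<lambda>h. hessian f (x0 + fst z) *v h)) (at (x0 + fst z))"
      by (simp add: jacobian_works hessian_def)
    then have "((\<lambda>z. grad f (x0 + fst z)) has_derivative (\<lambda>h. hessian f (x0 + fst z) *v fst h)) (at z)"
      by (rule has_derivative_compose[rotated]) (auto intro!: derivative_eq_intros)
    then show ?thesis
      unfolding red_map_def d_def case_prod_unfold
      by (auto intro!: derivative_eq_intros has_derivative_Pair
          bounded_linear.has_derivative[OF P] mv simp del: transpose_matrix_vector)
  qed
  then have bl: "bounded_linear (d z)" if "z \<in> N" for z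
    using that has_derivative_bounded_linear by blast
  define D where "D = (\<lambda>z. Blinfun (d z))"
  have D: "blinfun_apply (D z) = d z" if "z \<in> N" for z
    using bl[OF that] by (simp add: D_def bounded_linear_Blinfun_apply)
  have "continuous_on N D"
  \<comment> \<open>In finite dimension, continuity in the operator norm can be checked on one
    vector at a time.\<close>
  proof (rule continuous_on_blinfun_componentwise)
    fix i :: "(real^'n) \<times> (real^'m)"
    have "continuous_on N (\<lambda>z. hessian f (x0 + fst z))"
      by (rule continuous_on_compose2[OF M(4)]) (auto intro!: continuous_intros simp: N_def)
    then have "continuous_on N (\<lambda>z. hessian f (x0 + fst z) *v fst i)"
      unfolding matrix_vector_mult_def by (intro continuous_intros)
    then have "continuous_on N (\<lambda>z. d z i)"
      unfolding d_def
      by (intro continuous_intros bounded_linear.continuous_on[OF P])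
    then show "continuous_on N (\<lambda>z. blinfun_apply (D z) i)"
      by (rule continuous_on_eq) (simp add: D)
  qed
  moreover have "open N"
    unfolding N_def by (intro continuous_open_vimage continuous_intros M(1)) 
  moreover have N0: "(0, y0) \<in> N"
    using M(2) by (simp add: N_def)
  moreover have "blinfun_apply (D (0, y0)) h = red_jacobian A \<sigma> f F H x0 h" if "h \<in> red_space F" for h
  proof -
    have "fst h \<in> dir_space F"
      using that by (auto simp: red_space_def)
    then have Ph: "?P (fst h) = fst h"
      by (rule orth_proj_id[OF subspace_dir_space])
    have arg: "hessian f x0 *v fst h + H *v fst h - transpose A *v snd h
          + \<sigma> *\<^sub>R (transpose A *v (A *v fst h))
        = (hessian f x0 + H + \<sigma> *\<^sub>R (transpose A ** A)) *v fst h - transpose A *v snd h"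
      by (simp add: matrix_vector_mult_add_rdistrib scaleR_matrix_vector_assoc[symmetric]
          matrix_vector_mul_assoc)
    show ?thesis
      using Ph by (simp only: D[OF N0] d_def red_jacobian_def case_prod_unfold Let_def
          fst_conv add_0_right arg linear_diff[OF bounded_linear.linear[OF P]])
  qed
  ultimately show thesis
    using that[of N D] deriv D by metis
qed

text \<open>Injectivity on a finite-dimensional subspace gives a lower bound \<open>e\<close> for
  \<open>J\<close>. Near \<open>z0\<close> the linearization error uses up at most half of it, and
  the other half is the constant \<open>\<alpha>\<close>.\<close>

lemma local_error_bound:
  fixes T J :: "'a::euclidean_space \<Rightarrow> 'b::euclidean_space"
  assumes E: "subspace E" "z0 \<in> E"
    and T: "(T has_derivative J) (at z0 within E)" "T z0 = 0"
    and inj: "inj_on J E"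
  obtains V \<alpha> where "nbhd_in E z0 V" "\<alpha> > 0" "\<And>z. z \<in> V \<Longrightarrow> \<alpha> * norm (z - z0) \<le> norm (T z)"
proof -
  have J: "bounded_linear J"
    using T(1) by (rule has_derivative_bounded_linear)
  have "\<forall>x\<in>E. J x = 0 \<longrightarrow> x = 0"
    using inj subspace_0[OF E(1)] linear_0[OF bounded_linear.linear[OF J]]
    by (metis inj_onD)
  then obtain e where e: "e > 0" "\<forall>x\<in>E. norm (J x) \<ge> e * norm x"
    using injective_imp_isometric[OF closed_subspace[OF E(1)] E(1) J] by blast
  obtain d where d: "d > 0"
    "\<forall>z\<in>E. norm (z - z0) < d \<longrightarrow> norm (T z - T z0 - J (z - z0)) \<le> e / 2 * norm (z - z0)"
    using T(1) e(1) unfolding has_derivative_within_alt by (meson half_gt_zero)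
  have "e / 2 * norm (z - z0) \<le> norm (T z)" if "z \<in> E \<inter> ball z0 d" for z
  proof -
    have "norm (T z - J (z - z0)) \<le> e / 2 * norm (z - z0)"
      using that d(2) T(2) by (simp add: dist_norm norm_minus_commute[of z0])
    moreover have "e * norm (z - z0) \<le> norm (J (z - z0))"
      using that e(2) E subspace_diff by blast
    moreover have "norm (J (z - z0)) \<le> norm (T z) + norm (T z - J (z - z0))"
      by norm
    ultimately show ?thesis by simp
  qed
  then show thesis
    using that[of "E \<inter> ball z0 d" "e / 2"] nbhd_in_Int_open[of "ball z0 d" z0 E] e(1) d(1) E(2)
    by simp
qed

text \<open>A second zero would, by convexity of the KKT set, be joined to \<open>(0, y0)\<close> by a segment
  of KKT points; this makes the isolation of \<open>(0, y0)\<close> global.\<close>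

lemma red_map_zero_unique:
  fixes A :: "real^'n^'m"
  assumes f: "convex_on UNIV f" "f differentiable_on UNIV" and g: "proper_closed_convex g"
    and kkt: "(x0, y0) \<in> kkt_points A b \<sigma> f g"
    and U0: "red_nbhd A b \<sigma> f g F H c x0 y0 U0"
    and V: "nbhd_in (red_space F) (0, y0) V"
    and isolated: "\<And>z. z \<in> V \<Longrightarrow> red_map A \<sigma> f F H c x0 z = 0 \<Longrightarrow> z = (0, y0)"
    and U: "red_nbhd A b \<sigma> f g F H c x0 y0 U"
    and z: "z \<in> U" "red_map A \<sigma> f F H c x0 z = 0"
  shows "z = (0, y0)"
proof -
  let ?E = "red_space F :: ((real^'n) \<times> (real^'m)) set"
  obtain u y where uy: "z = (u, y)" by (metis surj_pair)
  \<comment> \<open>The segment from \<open>(0, y0)\<close> to \<open>z\<close> in reduced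
    coordinates; shifting its first component by \<open>x0\<close> gives the segment of KKT points
    in \<open>seg\<close>.\<close>
  define p where "p = (\<lambda>t::real. (t *\<^sub>R u, (1 - t) *\<^sub>R y0 + t *\<^sub>R y))"
  have "(x0 + u, y) \<in> kkt_points A b \<sigma> f g"
    using red_nbhd_zero_iff[OF g U] z uy by blast
  from convexD_alt[OF convex_kkt_points[OF f g] kkt this]
  have seg: "(x0 + t *\<^sub>R u, (1 - t) *\<^sub>R y0 + t *\<^sub>R y) \<in> kkt_points A b \<sigma> f g"
    if "0 \<le> t" "t \<le> 1" for t
    using that by (auto simp: algebra_simps dest: meta_spec[of _ t])
  obtain W1 W2 where W: "open W1" "(0, y0) \<in> W1" "?E \<inter> W1 \<subseteq> U0"
    "open W2" "(0, y0) \<in> W2" "?E \<inter> W2 \<subseteq> V"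
    using U0 V unfolding red_nbhd_def nbhd_in_def openin_open by blast
  have pE: "p t \<in> ?E" for t
  proof -
    have "u \<in> dir_space F"
      using U z(1) uy unfolding red_nbhd_def nbhd_in_def by (auto simp: red_space_def)
    then show ?thesis
      by (simp add: p_def red_space_def subspace_scale subspace_dir_space)
  qed
  \<comment> \<open>Even if \<open>z\<close> is far away, small positive \<open>t\<close> put
    \<open>p t\<close> inside both \<open>U0\<close> and \<open>V\<close>, where KKT points are
    zeros and zeros are isolated.\<close>
  have "((\<lambda>t. p t) \<longlongrightarrow> p 0) (at_right 0)"
    unfolding p_def by (intro tendsto_intros)
  moreover have "open (W1 \<inter> W2)" "p 0 \<in> W1 \<inter> W2"
    using W by (auto simp: p_def)
  ultimately have "\<forall>\<^sub>F t in at_right 0. p t \<in> W1 \<inter> W2"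
    by (rule topological_tendstoD)
  moreover have "\<forall>\<^sub>F t in at_right 0. t \<in> {0<..<1::real}"
    by (rule eventually_at_right_real) simp
  ultimately have "\<forall>\<^sub>F t in at_right 0. p t \<in> W1 \<inter> W2 \<and> t \<in> {0<..<1}"
    by (rule eventually_conj)
  then obtain t where t: "p t \<in> W1" "p t \<in> W2" "0 < t" "t < 1"
    using eventually_happens' trivial_limit_at_right_real
    by (metis (no_types, lifting) Int_iff greaterThanLessThan_iff)
  have "p t \<in> U0" "p t \<in> V"
    using W t pE by auto
  then have "red_map A \<sigma> f F H c x0 (p t) = 0"
    using seg[of t] t red_nbhd_zero_iff[OF g U0] unfolding p_def by auto
  with \<open>p t \<in> V\<close> have "p t = (0, y0)"
    by (rule isolated)
  \<comment> \<open>The displacement \<open>p t - (0, y0)\<close> is \<open>t\<close> times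
    \<open>(u, y - y0)\<close>, so positivity of \<open>t\<close> carries the conclusion back to
    \<open>z\<close>.\<close>
  then have "u = 0" "t *\<^sub>R (y - y0) = 0"
    using t by (auto simp: p_def algebra_simps)
  then show ?thesis
    using t by (simp add: uy)
qed

text \<open>Nonsingularity is bijectivity on \<open>red_space F\<close>: on the full product space
  \<open>red_jacobian\<close> kills every \<open>(h, 0)\<close> with \<open>h\<close> orthogonal to
  the direction space. \<open>V\<close> and \<open>\<alpha>\<close> are chosen before
  \<open>U\<close>, so they serve all admissible neighbourhoods at once.\<close>

theorem proposition11:
  fixes A :: "real^'n^'m" and b :: "real^'m" and \<sigma> :: real
    and f :: "real^'n \<Rightarrow> real" and g :: "real^'n \<Rightarrow> ereal"
    and xs :: "real^'n" and ys :: "real^'m"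
    and F Ux :: "(real^'n) set" and H :: "real^'n^'n" and c :: "real^'n"
  assumes "\<sigma> \<ge> 0"
    and "convex_on UNIV f"
    and "f differentiable_on UNIV"
    and "continuous_on UNIV (grad f)"
    and "\<exists>L. L-lipschitz_on UNIV (grad f)"
    and "proper_closed_convex g"
    and "(xs, ys) \<in> kkt_points A b \<sigma> f g"
    and "affine F" and "xs \<in> F"
    and "xs \<in> interior Ux"
    and "transpose H = H" and "\<forall>v. 0 \<le> v \<bullet> (H *v v)"
    and "\<forall>x \<in> F \<inter> Ux. subdifferential g x = {H *v x + c + v | v. v \<in> (dir_space F)\<^sup>\<bottom>}"
    and "C2_near f xs"
  shows "let zs = (0, ys);
             E = (red_space F :: ((real^'n) \<times> (real^'m)) set);
             T = red_map A \<sigma> f F H c xs;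
             J = red_jacobian A \<sigma> f F H xs
         in
           (\<exists>W (D :: (real^'n) \<times> (real^'m) \<Rightarrow> ((real^'n) \<times> (real^'m)) \<Rightarrow>\<^sub>L ((real^'n) \<times> (real^'m))).
              nbhd_in E zs W \<and>
              (\<forall>z\<in>W. (T has_derivative blinfun_apply (D z)) (at z within E)) \<and>
              continuous_on W D \<and>
              (\<forall>h\<in>E. blinfun_apply (D zs) h = J h)) \<and>
           (\<exists>U. red_nbhd A b \<sigma> f g F H c xs ys U) \<and>
           (bij_betw J E E \<longrightarrow>
             (\<exists>V \<alpha>. nbhd_in E zs V \<and> \<alpha> > 0 \<and>
                (\<forall>z\<in>V. \<alpha> * norm (z - zs) \<le> norm (T z)) \<and>
                (\<forall>U. red_nbhd A b \<sigma> f g F H c xs ys U \<longrightarrow>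
                   {z\<in>U. T z = 0} = {zs} \<and>
                   (\<exists>V'\<subseteq>V. nbhd_in E zs V' \<and>
                      (\<forall>z\<in>V'. \<alpha> * infdist z {z\<in>U. T z = 0} \<le> norm (T z))))))"
proof -
  let ?zs = "(0, ys) :: (real^'n) \<times> (real^'m)"
  let ?E = "red_space F :: ((real^'n) \<times> (real^'m)) set"
  let ?T = "red_map A \<sigma> f F H c xs" and ?J = "red_jacobian A \<sigma> f F H xs"
  have f: "convex_on UNIV f" "f differentiable_on UNIV" and g: "proper_closed_convex g"
    and kkt: "(xs, ys) \<in> kkt_points A b \<sigma> f g"
    using assms by blast+
  have zsE: "?zs \<in> ?E"
    by (simp add: red_space_def subspace_0 subspace_dir_space)
  obtain N D where N: "open N" "?zs \<in> N"
    and D: "\<And>z. z \<in> N \<Longrightarrow> (?T has_derivative blinfun_apply (D z)) (at z)" "continuous_on N D"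
    and DJ: "\<And>h. h \<in> ?E \<Longrightarrow> blinfun_apply (D ?zs) h = ?J h"
    by (rule red_map_C1[OF \<open>C2_near f xs\<close>, of ys A \<sigma> F H c]) (rule that)
  have C1: "\<exists>W D. nbhd_in ?E ?zs W \<and> (\<forall>z\<in>W. (?T has_derivative blinfun_apply (D z)) (at z within ?E)) \<and>
      continuous_on W D \<and> (\<forall>h\<in>?E. blinfun_apply (D ?zs) h = ?J h)"
    using nbhd_in_Int_open[OF N zsE] D DJ
    by (meson IntD2 Int_lower2 continuous_on_subset has_derivative_at_withinI)
  obtain U0 where U0: "red_nbhd A b \<sigma> f g F H c xs ys U0"
    using ex_red_nbhd[OF kkt assms(8-10,13)] by (rule exE)
  have zs_in: "?zs \<in> U" if "red_nbhd A b \<sigma> f g F H c xs ys U" for U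
    using that by (auto simp: red_nbhd_def intro: nbhd_in_self)
  \<comment> \<open>The KKT condition at the base point transfers to the reduced map through the
    admissible neighbourhood \<open>U0\<close>.\<close>
  have T0: "?T ?zs = 0"
    using red_nbhd_zero_iff[OF g U0 zs_in[OF U0]] kkt by simp
  have "\<exists>V \<alpha>. nbhd_in ?E ?zs V \<and> \<alpha> > 0 \<and> (\<forall>z\<in>V. \<alpha> * norm (z - ?zs) \<le> norm (?T z)) \<and>
      (\<forall>U. red_nbhd A b \<sigma> f g F H c xs ys U \<longrightarrow> {z\<in>U. ?T z = 0} = {?zs} \<and>
         (\<exists>V'\<subseteq>V. nbhd_in ?E ?zs V' \<and> (\<forall>z\<in>V'. \<alpha> * infdist z {z\<in>U. ?T z = 0} \<le> norm (?T z))))"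
    if "bij_betw ?J ?E ?E"
  proof -
    have inj: "inj_on (blinfun_apply (D ?zs)) ?E"
      using bij_betw_imp_inj_on[OF that] DJ by (simp cong: inj_on_cong)
    have deriv: "(?T has_derivative blinfun_apply (D ?zs)) (at ?zs within ?E)"
      using D(1) N(2) has_derivative_at_withinI by blast
    obtain V \<alpha> where V: "nbhd_in ?E ?zs V" "\<alpha> > 0"
      and bound: "\<And>z. z \<in> V \<Longrightarrow> \<alpha> * norm (z - ?zs) \<le> norm (?T z)"
      by (rule local_error_bound[OF subspace_red_space zsE deriv T0 inj]) (rule that)
    have isolated: "z = ?zs" if "z \<in> V" "?T z = 0" for z
      using bound[OF that(1)] that(2) V(2) by (simp add: mult_le_0_iff)
    have zeros: "{z\<in>U. ?T z = 0} = {?zs}" if U: "red_nbhd A b \<sigma> f g F H c xs ys U" for U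
    proof -
      have "z = ?zs" if "z \<in> U" "?T z = 0" for z
        by (rule red_map_zero_unique[OF f g kkt U0 V(1) _ U that]) (rule isolated)
      then show ?thesis
        using zs_in[OF U] T0 by blast
    qed
    \<comment> \<open>\<open>V\<close> itself serves as \<open>V'\<close>: the zero set in
      \<open>U\<close> is a single point, so the distance to it is
      \<open>norm (z - ?zs)\<close>.\<close>
    have "\<forall>z\<in>V. \<alpha> * infdist z {z\<in>U. ?T z = 0} \<le> norm (?T z)"
      if "red_nbhd A b \<sigma> f g F H c xs ys U" for U
      unfolding zeros[OF that] using bound by (simp add: dist_norm)
    with V bound zeros show ?thesis
      by blast
  qed
  with C1 U0 show ?thesis
    unfolding Let_def by blast
qed

end
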